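(* Let $f\colon[0,1)\to\mathbb{R}$ be a function and let $\epsilon\in(0,1)$, $a,b,r\in\mathbb{R}^+$ be constants such that $f$ is monotone increasing on $[0,\epsilon]$ and $a x^r\le f(x)\le b x^r$ for every $x\in[0,\epsilon]$. Let $m\ge 1$, let $k_1\ge k_2\ge\dots\ge k_m>0$ be real numbers, and put $K=\sum_{i=1}^m k_i$. Let $\lambda,\mu\in\mathbb{R}^+$ and $s\in\mathbb{N}$ be such that each of the numbers $\mu,\mu+\lambda,\mu+2\lambda,\dots,\mu+s\lambda$ is a subsum of $\sum_{i=1}^m k_i$. Put $$d_{CI}=\sqrt[r]{\frac{b}{s a+b}},\qquad d_{NI}=\sqrt[r]{\frac{a k_m}{bK+a k_m}}.$$ Suppose $d_{CI}<\epsilon$ and $d_{CI}<d_{NI}$. Then for every $x\in[d_{CI},d_{NI})$ with $x<\epsilon$ the achievement set $E\bigl(w_n(x)\bigr)$ is a Cantorval.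
   Context: The achievement set of a summable sequence $(z_n)_{n\ge1}$ of non-negative reals is $E(z_n)=\{\sum_{n=1}^\infty c_n z_n : c_n\in\{0,1\}\}$. Given $f$ and $k_1,\dots,k_m$ as in the claim, the generalized multigeometric sequence is $w_n(x)=k_{g(n)}\,f\bigl(x^{\lfloor (m+n-1)/m\rfloor}\bigr)$ for $n\ge1$, where $g(n)=1+((n-1)\bmod m)$; that is, the sequence $k_1f(x),\dots,k_mf(x),k_1f(x^2),\dots,k_mf(x^2),\dots$. A subsum of $\sum_{i=1}^m k_i$ is a number of the form $\sum_{i=1}^m c_i k_i$ with $c_i\in\{0,1\}$. A Cantorval is a nonempty compact subset of $\mathbb{R}$ which is the closure of its interior and such that the endpoints of any nontrivial connected component (i.e., a component that is not a single point) are accumulation points of trivial (one-point) components of the set. "Monotone increasing" on $[0,\epsilon]$ means $f(x)\le f(y)$ whenever $0\le x\le y\le\epsilon$. $\sqrt[r]{t}$ denotes $t^{1/r}$, with $r$ a positive real. *)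

theory Defs
  imports "HOL-Analysis.Analysis"
begin

text \<open>Sequences \<open>(z\<^sub>n)\<close> are indexed by \<open>n \<ge> 1\<close>: the value \<open>z 0\<close> is never used.\<close>

definition achievement_set :: "(nat \<Rightarrow> real) \<Rightarrow> real set" where
  "achievement_set z =
     {t. \<exists>c :: nat \<Rightarrow> real. (\<forall>n\<ge>1. c n \<in> {0, 1}) \<and> (\<lambda>n. c (Suc n) * z (Suc n)) sums t}"

definition multigeometric :: "nat \<Rightarrow> (nat \<Rightarrow> real) \<Rightarrow> (real \<Rightarrow> real) \<Rightarrow> real \<Rightarrow> nat \<Rightarrow> real" where
  "multigeometric m k f x n = k (1 + (n - 1) mod m) * f (x ^ ((m + n - 1) div m))"

definition is_subsum :: "nat \<Rightarrow> (nat \<Rightarrow> real) \<Rightarrow> real \<Rightarrow> bool" where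
  "is_subsum m k t \<longleftrightarrow>
     (\<exists>c :: nat \<Rightarrow> real. (\<forall>i\<in>{1..m}. c i \<in> {0, 1}) \<and> t = (\<Sum>i=1..m. c i * k i))"

definition trivial_component_points :: "real set \<Rightarrow> real set" where
  "trivial_component_points C = {t. {t} \<in> components C}"

text \<open>Components of a compact set of reals are compact and connected, so the nontrivial
  ones are exactly those of the form \<open>{u..v}\<close> with \<open>u < v\<close>.\<close>

definition cantorval :: "real set \<Rightarrow> bool" where
  "cantorval C \<longleftrightarrow>
     C \<noteq> {} \<and> compact C \<and> closure (interior C) = C \<and>
     (\<forall>u v. u < v \<and> {u..v} \<in> components C \<longrightarrow>
        u islimpt trivial_component_points C \<and> v islimpt trivial_component_points C)"

end

theory Submission
  imports Defs
begin

text \<open>Write \<open>F j = f (x ^ Suc j)\<close>. The terms of the sequence come in blocks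
  \<open>k 1 * F j, \<dots>, k m * F j\<close>, and \<open>F j\<close> is squeezed between \<open>a * q ^ Suc j\<close> and
  \<open>b * q ^ Suc j\<close> with \<open>q = x powr r\<close>, so geometric series bound all its tails. The two
  conditions on \<open>x\<close> then have separate meanings.

  The condition \<open>x < d_NI\<close> makes the smallest term \<open>k m * F j\<close> of a block larger than the sum of all
  later blocks. Since the terms of earlier blocks are no smaller, every block produces a gap of
  the achievement set just above the sum of the later blocks, and these gaps accumulate at \<open>0\<close>.
  The right end \<open>h\<close> of every gap inherits them: immediately to the right of \<open>h\<close> the set
  looks like the translate by \<open>h\<close> of the subset sums of a tail (\<open>missing_points_right_of_gap\<close>).
  Hence \<open>h\<close> is a trivial component. The gaps left of a nontrivial component \<open>{u..v}\<close> accumulate at \<open>u\<close>, so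
  their right ends are trivial components converging to \<open>u\<close>. The end \<open>v\<close> follows from the
  symmetry of subset sums under complementation of the index set.

  The condition \<open>d_CI \<le> x\<close> gives \<open>F j \<le> s * (F (j + 1) + F (j + 2) + \<dots>)\<close>. As in Kakeya's theorem,
  a greedy expansion with digits \<open>0, \<dots>, s\<close> shows that the sums of \<open>c j * F j\<close> fill an interval
  (\<open>digit_expansion\<close>). Choosing from block \<open>j\<close> the terms that add up to \<open>(mu + c j * lam) * F j\<close> turns
  this into an interval of subset sums. The same holds for every tail of the sequence, so translates of
  arbitrarily short sets with interior points lie near each point of the achievement set; it is
  therefore the closure of its interior.

  The topological half of the argument, \<open>cantorval_subset_sums\<close>, concerns arbitrary summable
  nonnegative weights; \<open>cantorval_block_weights\<close> adds the block structure.\<close>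

section \<open>Cantorvals on the real line\<close>

lemma isolating_gaps_imp_trivial_component:
  fixes E :: "real set"
  assumes "q \<in> E"
    and right: "\<And>\<delta>. 0 < \<delta> \<Longrightarrow> \<exists>z\<in>{q<..<q + \<delta>}. z \<notin> E"
    and left: "y < q" "{y..<q} \<inter> E = {}"
  shows "q \<in> trivial_component_points E"
proof -
  have "D = {q}" if D: "{q} \<subseteq> D" "D \<subseteq> E" "connected D" for D
  proof -
    have "d = q" if d: "d \<in> D" for d
    proof (rule linorder_cases[of d q])
      assume "d < q"
      then have "{d..q} \<subseteq> E"
        using connected_contains_Icc[OF D(3)] d D by blast
      moreover have "max d y \<in> {d..q}" "max d y \<in> {y..<q}"
        using \<open>d < q\<close> left by auto
      ultimately show ?thesis using left by blast
    next
      assume "q < d"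
      then have "{q..d} \<subseteq> E"
        using connected_contains_Icc[OF D(3)] d D by blast
      moreover obtain z where "z \<in> {q<..<d}" "z \<notin> E"
        using right[of "d - q"] \<open>q < d\<close> by auto
      moreover have "z \<in> {q..d}" using \<open>z \<in> {q<..<d}\<close> by simp
      ultimately show ?thesis by blast
    qed
    then show ?thesis using D(1) by blast
  qed
  then have "{q} \<in> components E"
    using \<open>q \<in> E\<close> by (subst in_components_maximal) auto
  then show ?thesis by (simp add: trivial_component_points_def)
qed

text \<open>Since \<open>{u..v}\<close> is maximal, there are points \<open>y\<close> outside \<open>E\<close> arbitrarily close to \<open>u\<close> on its left.
  The first point of \<open>E\<close> after \<open>y\<close> ends a gap, so by assumption it is a trivial component, and it lies
  between \<open>y\<close> and \<open>u\<close>.\<close>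

lemma left_end_islimpt_trivial:
  fixes E :: "real set"
  assumes "closed E"
    and right: "\<And>q y \<delta>. \<lbrakk>q \<in> E; y < q; {y..<q} \<inter> E = {}; 0 < \<delta>\<rbrakk> \<Longrightarrow> \<exists>z\<in>{q<..<q + \<delta>}. z \<notin> E"
    and comp: "{u..v} \<in> components E" "u < v"
  shows "u islimpt trivial_component_points E"
  unfolding islimpt_approachable
proof (intro allI impI)
  fix e :: real assume "0 < e"
  have sub: "{u..v} \<subseteq> E"
    using comp(1) by (rule in_components_subset)
  obtain y where y: "u - e < y" "y < u" "y \<notin> E"
  proof (rule ccontr)
    assume "\<not> thesis"
    then have "{u - e<..<u} \<subseteq> E"
      using that greaterThanLessThan_iff by blast
    then have "{u - e<..v} \<subseteq> E" using sub by force
    moreover have "{u..v} \<subseteq> {u - e<..v}" "connected {u - e<..v}"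
      using \<open>0 < e\<close> by auto
    ultimately have "{u - e<..v} = {u..v}"
      using comp by (metis (no_types, lifting) in_components_maximal subset_empty)
    moreover have "u - e / 2 \<in> {u - e<..v}"
      using \<open>0 < e\<close> comp(2) by auto
    ultimately show False using \<open>0 < e\<close> by auto
  qed
  define G where "G = E \<inter> {y..}"
  have G: "closed G" "u \<in> G" "bdd_below G"
    using \<open>closed E\<close> sub comp(2) y by (auto simp: G_def intro: closed_Int)
  define q where "q = Inf G"
  have "q \<in> G"
    unfolding q_def using G by (intro closed_contains_Inf) auto
  then have q: "q \<in> E" "y < q"
    using y by (auto simp: G_def less_le)
  have "q \<le> u"
    unfolding q_def using G by (intro cInf_lower)
  have gap: "{y..<q} \<inter> E = {}"
  proof -
    have "q \<le> t" if "t \<in> E" "y \<le> t" for t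
      unfolding q_def using G that by (intro cInf_lower) (auto simp: G_def)
    then show ?thesis by force
  qed
  have "q \<noteq> u"
  proof
    assume "q = u"
    then obtain z where "z \<in> {u<..<v}" "z \<notin> E"
      using right[OF q gap, of "v - u"] comp(2) by auto
    then show False using subsetD[OF sub, of z] by simp
  qed
  moreover have "q \<in> trivial_component_points E"
    using isolating_gaps_imp_trivial_component[OF q(1) right[OF q gap] q(2) gap] .
  ultimately show "\<exists>q\<in>trivial_component_points E. q \<noteq> u \<and> dist q u < e"
    using \<open>q \<le> u\<close> q y by (intro bexI[of _ q]) (auto simp: dist_real_def)
qed

lemma components_reflect:
  fixes E :: "real set"
  assumes sym: "(\<lambda>t. S - t) ` E = E" and C: "C \<in> components E"
  shows "(\<lambda>t. S - t) ` C \<in> components E"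
proof -
  let ?\<rho> = "\<lambda>t. S - t"
  have conn: "connected (?\<rho> ` D)" if "connected D" for D
    using that by (intro connected_continuous_image continuous_intros)
  have inv: "?\<rho> ` ?\<rho> ` D = D" for D
    by (simp add: image_image)
  have "D = ?\<rho> ` C" if D: "D \<noteq> {}" "?\<rho> ` C \<subseteq> D" "D \<subseteq> E" "connected D" for D
  proof -
    have "C \<subseteq> ?\<rho> ` D" "?\<rho> ` D \<subseteq> E"
      using image_mono[OF D(2), of ?\<rho>] image_mono[OF D(3), of ?\<rho>] inv sym by auto
    then have "?\<rho> ` D = C"
      using C D conn[OF D(4)] unfolding in_components_maximal by (metis image_is_empty)
    then show ?thesis using inv by metis
  qed
  moreover have "?\<rho> ` C \<subseteq> E"
    using C sym in_components_subset by blast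
  ultimately show ?thesis
    using C conn by (subst in_components_maximal) (auto simp: in_components_maximal)
qed

text \<open>A reflection that preserves \<open>E\<close> exchanges left and right ends of components, so it suffices to
  look to the right of each gap.\<close>

lemma symmetric_cantorvalI:
  fixes E :: "real set"
  assumes "E \<noteq> {}" "compact E" "closure (interior E) = E"
    and sym: "(\<lambda>t. S - t) ` E = E"
    and right: "\<And>q y \<delta>. \<lbrakk>q \<in> E; y < q; {y..<q} \<inter> E = {}; 0 < \<delta>\<rbrakk> \<Longrightarrow> \<exists>z\<in>{q<..<q + \<delta>}. z \<notin> E"
  shows "cantorval E"
proof -
  let ?T = "trivial_component_points E"
  have left_end: "u islimpt ?T" if "u < v" "{u..v} \<in> components E" for u v
    using left_end_islimpt_trivial[OF compact_imp_closed[OF assms(2)] right that(2) that(1)] .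
  have "v islimpt ?T" if uv: "u < v" "{u..v} \<in> components E" for u v
  proof -
    have "{S - v..S - u} \<in> components E"
      using components_reflect[OF sym uv(2)] by simp
    then have lim: "(S - v) islimpt ?T"
      by (rule left_end[rotated]) (use uv(1) in simp)
    have refl: "S - q \<in> ?T" if "q \<in> ?T" for q
      using components_reflect[OF sym, of "{q}"] that by (simp add: trivial_component_points_def)
    show ?thesis
      unfolding islimpt_approachable
    proof (intro allI impI)
      fix e :: real assume "0 < e"
      then obtain q where q: "q \<in> ?T" "q \<noteq> S - v" "dist q (S - v) < e"
        using lim unfolding islimpt_approachable by blast
      then show "\<exists>q\<in>?T. q \<noteq> v \<and> dist q v < e"
        by (intro bexI[OF _ refl[OF q(1)]]) (auto simp: dist_real_def)
    qed
  qed
  then show ?thesis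
    using assms left_end unfolding cantorval_def by blast
qed

section \<open>Sets of subset sums\<close>

lemma atLeast_eq_range_add: "{n :: nat..} = range ((+) n)"
  by (auto simp: nat_le_iff_add)

locale summable_weights =
  fixes w :: "nat \<Rightarrow> real"
  assumes nonneg: "0 \<le> w n" and summable: "w summable_on UNIV"
begin

definition subset_sums :: "nat set \<Rightarrow> real set" where
  "subset_sums A = infsum w ` Pow A"

lemma summable_on [simp]: "w summable_on A"
  using summable by (rule summable_on_subset_banach) simp

lemma infsum_w_nonneg: "0 \<le> infsum w A"
  by (rule infsum_nonneg) (rule nonneg)

lemma infsum_w_mono: "A \<subseteq> B \<Longrightarrow> infsum w A \<le> infsum w B"
  by (intro infsum_mono2) (auto simp: nonneg)

lemma infsum_w_split: "infsum w A = infsum w (A \<inter> {..<n}) + infsum w (A \<inter> {n..})"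
proof -
  have "A = (A \<inter> {..<n}) \<union> (A \<inter> {n..})" by auto
  then show ?thesis
    using infsum_Un_disjoint[of w "A \<inter> {..<n}" "A \<inter> {n..}"] by (metis (no_types, lifting)
      Int_commute Int_assoc disjoint_iff atLeast_iff lessThan_iff IntD2 not_less summable_on)
qed

lemma tail_tendsto_0: "(\<lambda>n. infsum w {n..}) \<longlonglongrightarrow> 0"
proof -
  have "(\<lambda>n. sum w {..<n}) \<longlonglongrightarrow> infsum w UNIV"
    using has_sum_imp_sums[OF has_sum_infsum[OF summable]] by (simp add: sums_def)
  then have "(\<lambda>n. infsum w UNIV - sum w {..<n}) \<longlonglongrightarrow> infsum w UNIV - infsum w UNIV"
    by (intro tendsto_intros)
  moreover have "infsum w {n..} = infsum w UNIV - sum w {..<n}" for n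
    using infsum_w_split[of UNIV n] by simp
  ultimately show ?thesis by simp
qed

lemma tail_less_arbitrarily_late:
  assumes "0 < e" and "\<exists>\<^sub>\<infinity>n. P n"
  obtains n where "P n" "infsum w {n..} < e"
proof -
  have "\<forall>\<^sub>F n in sequentially. infsum w {n..} < e"
    using order_tendstoD(2)[OF tail_tendsto_0 assms(1)] .
  then obtain N where "\<And>n. N \<le> n \<Longrightarrow> infsum w {n..} < e"
    by (auto simp: eventually_sequentially)
  then show ?thesis
    using assms(2) that unfolding INFM_nat_le by blast
qed

lemma subset_sums_UNIV: "subset_sums UNIV = range (infsum w)"
  by (simp add: subset_sums_def)

lemma reflect_subset_sums: "(\<lambda>t. infsum w UNIV - t) ` subset_sums UNIV = subset_sums UNIV"
proof -
  have compl: "infsum w UNIV - infsum w A = infsum w (- A)" for A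
    using infsum_Un_disjoint[of w A "- A"] by simp
  have "(\<lambda>t. infsum w UNIV - t) ` subset_sums UNIV = infsum w ` range uminus"
    by (simp add: subset_sums_UNIV image_image compl)
  also have "range uminus = (UNIV :: nat set set)"
    using double_complement by (metis surj_def)
  finally show ?thesis by (simp add: subset_sums_UNIV)
qed

lemma infsum_indicator: "(\<Sum>n. (if n \<in> A then 1 else 0) * w n) = infsum w A"
proof -
  have "infsum w A = (\<Sum>\<^sub>\<infinity>n. (if n \<in> A then 1 else 0) * w n)"
    by (rule infsum_cong_neutral) auto
  moreover have "(\<lambda>n. (if n \<in> A then 1 else 0) * w n) summable_on UNIV"
  proof -
    have "w summable_on A \<longleftrightarrow> (\<lambda>n. (if n \<in> A then 1 else 0) * w n) summable_on UNIV"
      by (rule summable_on_cong_neutral) auto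
    then show ?thesis by simp
  qed
  ultimately show ?thesis
    using has_sum_imp_sums[OF has_sum_infsum] by (metis sums_unique)
qed

text \<open>The space of 0-1-sequences is compact by Tychonoff's theorem, and the sum depends
  continuously on the sequence as a uniform limit of its partial sums.\<close>

lemma compact_subset_sums: "compact (subset_sums UNIV)"
proof -
  define X :: "(nat \<Rightarrow> real) set" where "X = PiE UNIV (\<lambda>_. {0, 1})"
  have "compactin (product_topology (\<lambda>_::nat. euclideanreal) UNIV) X"
    unfolding X_def by (subst compactin_PiE) auto
  then have "compact X"
    by (simp add: euclidean_product_topology)
  have "uniform_limit X (\<lambda>n c. \<Sum>i<n. c i * w i) (\<lambda>c. \<Sum>i. c i * w i) sequentially"
  proof (rule Weierstrass_m_test)
    show "norm (c n * w n) \<le> w n" if "c \<in> X" for n c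
    proof -
      have "c n \<in> {0, 1}" using that by (auto simp: X_def)
      then show ?thesis using nonneg[of n] by auto
    qed
    show "summable w" using summable_on_imp_summable[OF summable] .
  qed
  then have "continuous_on X (\<lambda>c. \<Sum>i. c i * w i)"
  proof (rule uniform_limit_theorem[rotated])
    have "continuous_on X (\<lambda>c. c i)" for i
      by (rule continuous_on_subset[OF continuous_on_product_coordinates]) simp
    then show "\<forall>\<^sub>F n in sequentially. continuous_on X (\<lambda>c. \<Sum>i<n. c i * w i)"
      by (intro always_eventually allI continuous_intros)
  qed simp
  then have "compact ((\<lambda>c. \<Sum>i. c i * w i) ` X)"
    using \<open>compact X\<close> by (rule compact_continuous_image)
  also have "(\<lambda>c. \<Sum>i. c i * w i) ` X = subset_sums UNIV"
  proof (intro equalityI subsetI)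
    fix t assume "t \<in> (\<lambda>c. \<Sum>i. c i * w i) ` X"
    then obtain c where c: "c \<in> X" "t = (\<Sum>i. c i * w i)" by auto
    have "c i = (if c i = 1 then 1 else 0)" for i
      using c(1) by (auto simp: X_def PiE_iff)
    then have "t = (\<Sum>i. (if i \<in> {i. c i = 1} then 1 else 0) * w i)"
      unfolding c(2) mem_Collect_eq by (intro suminf_cong arg_cong2[of _ _ _ _ "(*)"]) auto
    then have "t = infsum w {i. c i = 1}"
      by (simp only: infsum_indicator)
    then show "t \<in> subset_sums UNIV" by (simp add: subset_sums_UNIV)
  next
    fix t assume "t \<in> subset_sums UNIV"
    then obtain A where "t = infsum w A" by (auto simp: subset_sums_UNIV)
    then show "t \<in> (\<lambda>c. \<Sum>i. c i * w i) ` X"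
      by (intro image_eqI[of _ _ "\<lambda>n. if n \<in> A then 1 else 0"])
        (auto simp: infsum_indicator[symmetric] X_def split: if_splits)
  qed
  finally show ?thesis .
qed

text \<open>Given a subset sum, keep its part below \<open>n\<close> and replace the rest by an interior point of the
  tail's subset sums. The result is an interior point of the full set, and it moves by at
  most the length of the tail.\<close>

lemma closure_interior_subset_sums:
  assumes "\<exists>\<^sub>\<infinity>n. interior (subset_sums {n..}) \<noteq> {}"
  shows "closure (interior (subset_sums UNIV)) = subset_sums UNIV"
proof
  show "closure (interior (subset_sums UNIV)) \<subseteq> subset_sums UNIV"
    using compact_imp_closed[OF compact_subset_sums] interior_subset
    by (metis closure_minimal)
  show "subset_sums UNIV \<subseteq> closure (interior (subset_sums UNIV))"
  proof
    fix p assume "p \<in> subset_sums UNIV"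
    then obtain A where A: "p = infsum w A" by (auto simp: subset_sums_UNIV)
    show "p \<in> closure (interior (subset_sums UNIV))"
      unfolding closure_approachable
    proof (intro allI impI)
      fix e :: real assume "0 < e"
      then obtain n where n: "interior (subset_sums {n..}) \<noteq> {}" "infsum w {n..} < e"
        using assms tail_less_arbitrarily_late by blast
      let ?h = "infsum w (A \<inter> {..<n})"
      obtain g where g: "g \<in> interior (subset_sums {n..})"
        using n by auto
      have "(+) ?h ` subset_sums {n..} \<subseteq> subset_sums UNIV"
      proof (rule image_subsetI)
        fix t assume "t \<in> subset_sums {n..}"
        then obtain B where B: "B \<subseteq> {n..}" "t = infsum w B"
          by (auto simp: subset_sums_def)
        have "A \<inter> {..<n} \<inter> B = {}" using B by auto
        then have "?h + t = infsum w ((A \<inter> {..<n}) \<union> B)"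
          unfolding B(2) by (subst infsum_Un_disjoint) auto
        then show "?h + t \<in> subset_sums UNIV" by (auto simp: subset_sums_UNIV)
      qed
      then have "interior ((+) ?h ` subset_sums {n..}) \<subseteq> interior (subset_sums UNIV)"
        by (rule interior_mono)
      then have "?h + g \<in> interior (subset_sums UNIV)"
        using g by (auto simp: interior_translation)
      moreover have "0 \<le> g" "g \<le> infsum w {n..}"
      proof -
        obtain B where "B \<subseteq> {n..}" "g = infsum w B"
          using subsetD[OF interior_subset g] by (auto simp: subset_sums_def)
        then show "0 \<le> g" "g \<le> infsum w {n..}" using infsum_w_mono infsum_w_nonneg by auto
      qed
      moreover have "0 \<le> infsum w (A \<inter> {n..})" "infsum w (A \<inter> {n..}) \<le> infsum w {n..}"
        by (auto intro: infsum_w_mono infsum_w_nonneg)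
      ultimately show "\<exists>y\<in>interior (subset_sums UNIV). dist y p < e"
        using n(2) infsum_w_split[of A n] unfolding A
        by (intro bexI[of _ "?h + g"]) (auto simp: dist_real_def)
    qed
  qed
qed

text \<open>A subset sum either uses an index below \<open>n\<close>, and is then at least that weight, or it is bounded by
  the tail from \<open>n\<close> on. So whenever this tail is smaller than all earlier weights there is a gap just
  above it, and the tails tend to \<open>0\<close>.\<close>

lemma missing_points_near_0:
  assumes gap: "\<exists>\<^sub>\<infinity>n. \<forall>i<n. infsum w {n..} < w i" and "0 < \<delta>"
  obtains z where "0 < z" "z < \<delta>" "z \<notin> subset_sums UNIV"
proof -
  obtain n where n: "\<forall>i<n. infsum w {n..} < w i" "infsum w {n..} < \<delta>"
    using tail_less_arbitrarily_late[OF assms(2,1)] by blast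
  define M where "M = Min (insert \<delta> (w ` {..<n}))"
  have M: "infsum w {n..} < M" "M \<le> \<delta>" "\<And>i. i < n \<Longrightarrow> M \<le> w i"
    using n by (auto simp: M_def)
  obtain z where z: "infsum w {n..} < z" "z < M"
    using dense M(1) by blast
  have "z \<noteq> infsum w A" for A
  proof (cases "A \<inter> {..<n} = {}")
    case True
    then have "A \<subseteq> {n..}" by auto
    then show ?thesis using infsum_w_mono[of A "{n..}"] z by linarith
  next
    case False
    then obtain i where "i \<in> A" "i < n" by auto
    then show ?thesis using infsum_w_mono[of "{i}" A] M(3)[of i] z by auto
  qed
  then show ?thesis
    using that[of z] z M infsum_w_nonneg[of "{n..}"] by (auto simp: subset_sums_UNIV)
qed

text \<open>Let \<open>q\<close> be the right end of a gap and \<open>n\<close> so large that the tail from \<open>n\<close> on is shorter than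
  this gap. Of the finitely many translates of the set of tail sums that cover all subset sums, those
  starting left of \<open>q\<close> end left of \<open>q\<close>, hence \<open>q\<close> itself is one of the starting points, and
  just to the right of \<open>q\<close> there is only the translate starting at \<open>q\<close>. So \<open>q\<close> inherits the gaps
  that accumulate at \<open>0\<close>.\<close>

lemma missing_points_right_of_gap:
  assumes gap: "\<exists>\<^sub>\<infinity>n. \<forall>i<n. infsum w {n..} < w i"
    and q: "q \<in> subset_sums UNIV" and y: "y < q" "{y..<q} \<inter> subset_sums UNIV = {}"
    and "0 < \<delta>"
  shows "\<exists>z\<in>{q<..<q + \<delta>}. z \<notin> subset_sums UNIV"
proof -
  have y_or_q: "t < y \<or> q \<le> t" if "t \<in> subset_sums UNIV" for t
    using y that by (meson atLeastLessThan_iff disjoint_iff not_le)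
  obtain n where n: "infsum w {n..} < q - y"
    using tail_less_arbitrarily_late[of "q - y" "\<lambda>_. True"] y by (auto simp: INFM_nat_le)
  define H where "H = subset_sums {..<n}"
  have "finite H" by (simp add: H_def subset_sums_def)
  have decomp: "\<exists>h t. p = h + t \<and> h \<in> H \<and> (h < y \<or> q \<le> h) \<and> t \<in> subset_sums UNIV \<and> 0 \<le> t
      \<and> t \<le> infsum w {n..}" if "p \<in> subset_sums UNIV" for p
  proof -
    obtain A where A: "p = infsum w A" using \<open>p \<in> _\<close> by (auto simp: subset_sums_UNIV)
    have "infsum w (A \<inter> {..<n}) \<in> subset_sums UNIV"
      unfolding subset_sums_UNIV by (rule rangeI)
    note y_or_q[OF this]
    moreover have "infsum w (A \<inter> {n..}) \<le> infsum w {n..}"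
      by (intro infsum_w_mono) auto
    moreover have "infsum w (A \<inter> {..<n}) \<in> H"
      unfolding H_def subset_sums_def by (rule imageI) auto
    moreover have "infsum w (A \<inter> {n..}) \<in> subset_sums UNIV"
      by (auto simp: subset_sums_UNIV)
    ultimately show ?thesis
      unfolding A infsum_w_split[of A n] using infsum_w_nonneg by blast
  qed
  \<comment> \<open>The distance from \<open>q\<close> to the next starting point, cut off at \<open>\<delta>\<close>.\<close>
  define \<eta> where "\<eta> = Min (insert \<delta> ((\<lambda>h. h - q) ` {h \<in> H. q < h}))"
  have \<eta>: "0 < \<eta>" "\<eta> \<le> \<delta>" "\<And>h. h \<in> H \<Longrightarrow> q < h \<Longrightarrow> q + \<eta> \<le> h"
  proof -
    show "0 < \<eta>" "\<eta> \<le> \<delta>" using \<open>0 < \<delta>\<close> \<open>finite H\<close> by (auto simp: \<eta>_def)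
    fix h assume "h \<in> H" "q < h"
    then have "\<eta> \<le> h - q" unfolding \<eta>_def using \<open>finite H\<close> by (intro Min_le) auto
    then show "q + \<eta> \<le> h" by simp
  qed
  obtain z where z: "0 < z" "z < \<eta>" "z \<notin> subset_sums UNIV"
    using missing_points_near_0[OF gap \<eta>(1)] by blast
  have "q + z \<notin> subset_sums UNIV"
  proof
    assume "q + z \<in> subset_sums UNIV"
    from decomp[OF this] obtain h t where ht: "q + z = h + t" "h \<in> H" "h < y \<or> q \<le> h"
      "t \<in> subset_sums UNIV" "0 \<le> t" "t \<le> infsum w {n..}" by blast
    then have "q \<le> h" using n z by linarith
    moreover have "\<not> q < h" using \<eta>(3)[OF ht(2)] ht z by linarith
    ultimately show False using ht z by auto
  qed
  then show ?thesis using z \<eta> by (intro bexI[of _ "q + z"]) auto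
qed

text \<open>It is enough to know gaps and interior points at infinitely many positions, such as the
  boundaries between the blocks below.\<close>

theorem cantorval_subset_sums:
  assumes "\<exists>\<^sub>\<infinity>n. \<forall>i<n. infsum w {n..} < w i"
    and "\<exists>\<^sub>\<infinity>n. interior (subset_sums {n..}) \<noteq> {}"
  shows "cantorval (subset_sums UNIV)"
proof (rule symmetric_cantorvalI)
  show "subset_sums UNIV \<noteq> {}" by (simp add: subset_sums_UNIV)
qed (use compact_subset_sums closure_interior_subset_sums[OF assms(2)] reflect_subset_sums
  missing_points_right_of_gap[OF assms(1)] in blast)+

lemma subset_sums_eq_achievement_set:
  assumes "\<And>n. z (Suc n) = w n"
  shows "subset_sums UNIV = achievement_set z"
proof (intro equalityI subsetI)
  fix t assume "t \<in> subset_sums UNIV"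
  then obtain A where A: "t = infsum w A" by (auto simp: subset_sums_UNIV)
  let ?c = "\<lambda>n. if n - 1 \<in> A then 1 else 0 :: real"
  have "(\<lambda>n. (if n \<in> A then 1 else 0) * w n) sums t"
    unfolding A by (subst infsum_indicator[symmetric], rule summable_sums,
      rule summable_comparison_test'[OF summable_on_imp_summable[OF summable]]) (auto simp: nonneg)
  then have "(\<forall>n\<ge>1. ?c n \<in> {0, 1}) \<and> (\<lambda>n. ?c (Suc n) * z (Suc n)) sums t"
    by (simp add: assms)
  then show "t \<in> achievement_set z"
    unfolding achievement_set_def by (intro CollectI exI[of _ ?c])
next
  fix t assume "t \<in> achievement_set z"
  then obtain c where c: "\<And>n. n \<ge> 1 \<Longrightarrow> c n \<in> {0, 1 :: real}"
    "(\<lambda>n. c (Suc n) * z (Suc n)) sums t"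
    by (auto simp: achievement_set_def)
  have "c (Suc n) = (if c (Suc n) = 1 then 1 else 0)" for n
    using c(1)[of "Suc n"] by auto
  then have "t = (\<Sum>n. (if n \<in> {n. c (Suc n) = 1} then 1 else 0) * w n)"
    unfolding sums_unique[OF c(2)] assms mem_Collect_eq
    by (intro suminf_cong arg_cong2[of _ _ _ _ "(*)"]) auto
  then have "t = infsum w {n. c (Suc n) = 1}"
    by (simp only: infsum_indicator)
  then show "t \<in> subset_sums UNIV" by (simp add: subset_sums_UNIV)
qed

end

section \<open>Intervals of digit sums\<close>

text \<open>Greedy choice of the largest possible digit: if the digit is \<open>s\<close> the remainder stays below
  \<open>s\<close> times the next tail because it did so before, otherwise because it is below \<open>F n\<close>.\<close>

lemma digit_expansion:
  fixes F :: "nat \<Rightarrow> real"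
  assumes pos: "\<And>n. 0 < F n" and summ: "F summable_on UNIV"
    and tail: "\<And>n. F n \<le> real s * infsum F {Suc n..}"
    and t: "0 \<le> t" "t \<le> real s * infsum F {N..}"
  obtains c :: "nat \<Rightarrow> nat" where "\<And>j. c j \<le> s" "((\<lambda>j. real (c j) * F j) has_sum t) {N..}"
proof -
  interpret summable_weights F
    using summ pos by unfold_locales (auto intro: less_imp_le)
  \<comment> \<open>\<open>?P\<close> is the invariant of the remainders, \<open>?Q\<close> the removal of the digit at \<open>N + n\<close>.\<close>
  let ?P = "\<lambda>n x. 0 \<le> x \<and> x \<le> real s * infsum F {N + n..} \<and> (n = 0 \<longrightarrow> x = t)"
  let ?Q = "\<lambda>n x y. \<exists>d\<le>s. y = x - real d * F (N + n)"
  have "\<exists>y. ?P (Suc n) y \<and> ?Q n x y" if "?P n x" for n x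
  proof -
    have R: "infsum F {N + n..} = F (N + n) + infsum F {Suc (N + n)..}"
    proof -
      have "{N + n..} \<inter> {..<Suc (N + n)} = {N + n}" "{N + n..} \<inter> {Suc (N + n)..} = {Suc (N + n)..}"
        by auto
      then show ?thesis using infsum_w_split[of "{N + n..}" "Suc (N + n)"] by simp
    qed
    define d where "d = min s (nat \<lfloor>x / F (N + n)\<rfloor>)"
    have "d \<le> s" by (simp add: d_def)
    have q: "0 \<le> x / F (N + n)"
      using that pos[of "N + n"] by simp
    have "real d \<le> x / F (N + n)"
      using of_int_floor_le[of "x / F (N + n)"] q unfolding d_def by linarith
    then have lower: "0 \<le> x - real d * F (N + n)"
      using pos[of "N + n"] by (simp add: field_simps)
    have "x - real d * F (N + n) \<le> real s * infsum F {Suc (N + n)..}"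
    proof (cases "d = s")
      case True
      then show ?thesis using that R by (simp add: algebra_simps)
    next
      case False
      then have "x / F (N + n) < real d + 1"
        unfolding d_def by linarith
      then have "x - real d * F (N + n) < F (N + n)"
        using pos[of "N + n"] by (simp add: field_simps)
      then show ?thesis using tail[of "N + n"] by linarith
    qed
    then show ?thesis
      using lower \<open>d \<le> s\<close> by (intro exI[of _ "x - real d * F (N + n)"] conjI exI[of _ d]) auto
  qed
  moreover have "\<exists>x. ?P 0 x" using t by auto
  ultimately have "\<exists>g. \<forall>n. ?P n (g n) \<and> ?Q n (g n) (g (Suc n))"
    by (intro dependent_nat_choice)
  then obtain g where g: "\<And>n. ?P n (g n)" "\<And>n. ?Q n (g n) (g (Suc n))"
    by (elim exE) meson
  then have "\<exists>d. \<forall>n. d n \<le> s \<and> g (Suc n) = g n - real (d n) * F (N + n)"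
    by (intro choice allI)
  then obtain d where d: "\<And>n. d n \<le> s" "\<And>n. g (Suc n) = g n - real (d n) * F (N + n)"
    by blast
  have partial: "(\<Sum>i<n. real (d i) * F (N + i)) = t - g n" for n
    by (induction n) (use g(1)[of 0] d(2) in auto)
  have "(\<lambda>n. real s * infsum F {N + n..}) \<longlonglongrightarrow> real s * 0"
    using LIMSEQ_ignore_initial_segment[OF tail_tendsto_0, of N]
    by (intro tendsto_intros) (simp add: add.commute)
  then have "g \<longlonglongrightarrow> 0"
    using g(1) by (intro tendsto_sandwich[of "\<lambda>_. 0" g _ "\<lambda>n. real s * infsum F {N + n..}"]) auto
  then have "(\<lambda>n. t - g n) \<longlonglongrightarrow> t - 0"
    by (intro tendsto_intros)
  then have "(\<lambda>i. real (d i) * F (N + i)) sums t"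
    by (simp add: sums_def partial)
  then have "((\<lambda>i. real (d i) * F (N + i)) has_sum t) UNIV"
    using pos by (intro sums_nonneg_imp_has_sum) (auto simp: less_imp_le)
  then have "((\<lambda>j. real (d (j - N)) * F j) has_sum t) {N..}"
    unfolding atLeast_eq_range_add by (subst has_sum_reindex) (simp_all add: o_def)
  then show ?thesis by (intro that[of "\<lambda>j. d (j - N)"] d(1))
qed

section \<open>Weights arranged in blocks\<close>

text \<open>A choice of positions \<open>B j\<close> in each block \<open>j \<in> J\<close> corresponds to a set of indices; both the
  tail sums and the intervals of subset sums are computed this way.\<close>

lemma block_has_sum:
  fixes \<kappa> F w :: "nat \<Rightarrow> real"
  assumes w: "\<And>j i. i < m \<Longrightarrow> w (m * j + i) = \<kappa> i * F j"
    and nonneg: "\<And>i. i < m \<Longrightarrow> 0 \<le> \<kappa> i" "\<And>j. 0 \<le> F j"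
    and B: "\<And>j. j \<in> J \<Longrightarrow> B j \<subseteq> {..<m}"
    and t: "((\<lambda>j. sum \<kappa> (B j) * F j) has_sum t) J"
  shows "(w has_sum t) ((\<lambda>(j, i). m * j + i) ` Sigma J B)"
proof -
  let ?h = "\<lambda>(j, i). m * j + i"
  have lt: "i < m" if "j \<in> J" "i \<in> B j" for i j
    using B that by blast
  have inj: "inj_on ?h (Sigma J B)"
  proof (intro inj_onI, clarify)
    fix j i j' i'
    assume ji: "j \<in> J" "i \<in> B j" "j' \<in> J" "i' \<in> B j'" and eq: "m * j + i = m * j' + i'"
    have "(m * j + i) div m = (m * j' + i') div m" "(m * j + i) mod m = (m * j' + i') mod m"
      using eq by auto
    then show "j = j' \<and> i = i'" using lt[OF ji(1,2)] lt[OF ji(3,4)] by auto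
  qed
  have inner: "((\<lambda>i. w (?h (j, i))) has_sum sum \<kappa> (B j) * F j) (B j)" if "j \<in> J" for j
    using B[OF that] finite_subset[OF B[OF that]] lt[OF that]
    by (intro has_sum_finiteI) (auto simp: w sum_distrib_right)
  have "(\<lambda>p. w (?h p)) summable_on Sigma J B"
    by (rule summable_on_SigmaI[OF inner]) (use t lt in \<open>auto simp: w nonneg summable_on_def\<close>)
  then have "((\<lambda>p. w (?h p)) has_sum t) (Sigma J B)"
    using inner t by (intro has_sum_SigmaI) auto
  then show ?thesis
    by (subst has_sum_reindex[OF inj]) (simp add: o_def)
qed

text \<open>The assumption \<open>gap\<close> compares the smallest weight of a block with the sum of all later
  blocks and yields the gaps at block boundaries. The assumption \<open>tail\<close> makes the digit sums over
  \<open>{0..s}\<close> fill an interval, which \<open>digits\<close> realizes by subsets of the blocks.\<close>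

theorem cantorval_block_weights:
  fixes \<kappa> F z :: "nat \<Rightarrow> real" and lam mu \<kappa>\<^sub>0 :: real and m s :: nat
  assumes "0 < m" and \<kappa>: "0 < \<kappa>\<^sub>0" "\<And>i. i < m \<Longrightarrow> \<kappa>\<^sub>0 \<le> \<kappa> i"
    and F: "\<And>j. 0 < F j" "decseq F" "F summable_on UNIV"
    and gap: "\<And>j. (\<Sum>i<m. \<kappa> i) * infsum F {Suc j..} < \<kappa>\<^sub>0 * F j"
    and tail: "\<And>j. F j \<le> real s * infsum F {Suc j..}"
    and digits: "0 < lam" "\<And>d. d \<le> s \<Longrightarrow> \<exists>B\<subseteq>{..<m}. (\<Sum>i\<in>B. \<kappa> i) = mu + real d * lam"
    and z: "\<And>n. z (Suc n) = \<kappa> (n mod m) * F (n div m)"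
  shows "cantorval (achievement_set z)"
proof -
  define w where "w n = z (Suc n)" for n
  have w: "w (m * j + i) = \<kappa> i * F j" if "i < m" for i j
    using that by (simp add: w_def z)
  have \<kappa>_nonneg: "0 \<le> \<kappa> i" if "i < m" for i
    using \<kappa> that by (meson less_imp_le order_trans)
  have F_nonneg: "0 \<le> F j" for j
    using F(1) by (simp add: less_imp_le)
  have F_summable: "F summable_on J" for J
    using F(3) by (rule summable_on_subset_banach) simp
  have block_eq: "(\<lambda>(j, i). m * j + i) ` ({N..} \<times> {..<m}) = {m * N..}" for N
  proof (intro equalityI subsetI)
    fix n assume "n \<in> {m * N..}"
    then have "N \<le> n div m" using \<open>0 < m\<close> by (simp add: less_eq_div_iff_mult_less_eq mult.commute)
    then show "n \<in> (\<lambda>(j, i). m * j + i) ` ({N..} \<times> {..<m})"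
      using \<open>0 < m\<close> by (intro image_eqI[of _ _ "(n div m, n mod m)"]) auto
  qed (auto intro: trans_le_add1)
  have w_tail: "(w has_sum (\<Sum>i<m. \<kappa> i) * infsum F {N..}) {m * N..}" for N
    using block_has_sum[of m w \<kappa> F "{N..}" "\<lambda>_. {..<m}", OF w \<kappa>_nonneg F_nonneg]
      has_sum_cmult_right[OF has_sum_infsum[OF F_summable]] unfolding block_eq by blast
  interpret summable_weights w
  proof
    show "0 \<le> w n" for n
      using \<kappa>_nonneg[of "n mod m"] F_nonneg \<open>0 < m\<close> by (simp add: w_def z)
    show "w summable_on UNIV"
      using w_tail[of 0] by (auto simp: summable_on_def)
  qed
  have "\<exists>\<^sub>\<infinity>n. \<forall>i<n. infsum w {n..} < w i"
    unfolding INFM_nat_le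
  proof (intro allI exI conjI impI)
    fix N i
    show "N \<le> m * Suc N" using \<open>0 < m\<close> by (cases m) auto
    assume i: "i < m * Suc N"
    then have "i div m \<le> N"
      by (metis less_mult_imp_div_less less_Suc_eq_le mult.commute)
    then have "F N \<le> F (i div m)" using F(2) by (simp add: decseqD)
    have "infsum w {m * Suc N..} = (\<Sum>i<m. \<kappa> i) * infsum F {Suc N..}"
      using infsumI[OF w_tail] .
    also have "\<dots> < \<kappa>\<^sub>0 * F N" by (rule gap)
    also have "\<dots> \<le> \<kappa> (i mod m) * F (i div m)"
      using \<open>F N \<le> F (i div m)\<close> \<kappa> \<kappa>_nonneg F_nonneg \<open>0 < m\<close> by (intro mult_mono) auto
    finally show "infsum w {m * Suc N..} < w i" by (simp add: w_def z)
  qed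
  moreover have "\<exists>\<^sub>\<infinity>n. interior (subset_sums {n..}) \<noteq> {}"
    unfolding INFM_nat_le
  proof (intro allI exI conjI)
    fix N
    show "N \<le> m * N" using \<open>0 < m\<close> by (cases m) auto
    define T where "T = infsum F {N..}"
    have "F N \<le> T"
      using infsum_mono2[of F "{N}" "{N..}"] F_summable F_nonneg by (simp add: T_def)
    then have "0 < T" using F(1)[of N] by linarith
    have "s \<noteq> 0" using tail[of 0] F(1)[of 0] by (intro notI) auto
    have "{mu * T<..<mu * T + lam * (real s * T)} \<subseteq> subset_sums {m * N..}"
    proof
      fix p assume p: "p \<in> {mu * T<..<mu * T + lam * (real s * T)}"
      define t where "t = (p - mu * T) / lam"
      have t: "0 \<le> t" "t \<le> real s * infsum F {N..}"
        using p digits(1) by (auto simp: t_def T_def[symmetric] field_simps)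
      obtain c where c: "\<And>j. c j \<le> s" "((\<lambda>j. real (c j) * F j) has_sum t) {N..}"
        using digit_expansion[OF F(1,3) tail t] by blast
      have "\<forall>j. \<exists>B\<subseteq>{..<m}. (\<Sum>i\<in>B. \<kappa> i) = mu + real (c j) * lam"
        using digits(2) c(1) by blast
      then obtain B where B: "\<And>j. B j \<subseteq> {..<m}" "\<And>j. (\<Sum>i\<in>B j. \<kappa> i) = mu + real (c j) * lam"
        by metis
      have "((\<lambda>j. mu * F j + lam * (real (c j) * F j)) has_sum mu * T + lam * t) {N..}"
        unfolding T_def by (intro has_sum_add has_sum_cmult_right has_sum_infsum F_summable c(2))
      also have "(\<lambda>j. mu * F j + lam * (real (c j) * F j)) = (\<lambda>j. sum \<kappa> (B j) * F j)"
        by (simp add: B(2) algebra_simps)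
      also have "mu * T + lam * t = p" using digits(1) by (simp add: t_def)
      finally have "(w has_sum p) ((\<lambda>(j, i). m * j + i) ` Sigma {N..} B)"
        using block_has_sum[of m w \<kappa> F "{N..}" B p, OF w \<kappa>_nonneg F_nonneg B(1)] by blast
      then have "p = infsum w ((\<lambda>(j, i). m * j + i) ` Sigma {N..} B)"
        using infsumI by metis
      moreover have "(\<lambda>(j, i). m * j + i) ` Sigma {N..} B \<subseteq> {m * N..}"
        unfolding block_eq[symmetric] using B(1) by (intro image_mono Sigma_mono) auto
      ultimately show "p \<in> subset_sums {m * N..}"
        by (auto simp: subset_sums_def)
    qed
    then have "{mu * T<..<mu * T + lam * (real s * T)} \<subseteq> interior (subset_sums {m * N..})"
      by (intro interior_maximal) auto
    moreover have "0 < lam * (real s * T)"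
      using \<open>0 < T\<close> \<open>s \<noteq> 0\<close> digits(1) by simp
    ultimately show "interior (subset_sums {m * N..}) \<noteq> {}"
      by auto
  qed
  ultimately show ?thesis
    using cantorval_subset_sums subset_sums_eq_achievement_set[of z] w_def by simp
qed

section \<open>Generalized multigeometric sequences\<close>

lemma geometric_tail_has_sum:
  fixes q :: real
  assumes "0 \<le> q" "q < 1"
  shows "((\<lambda>j. q ^ Suc j) has_sum q ^ Suc N / (1 - q)) {N..}"
proof -
  have "(\<lambda>i. q ^ Suc N * q ^ i) sums (q ^ Suc N * (1 / (1 - q)))"
    using assms by (intro sums_mult geometric_sums) auto
  then have "((\<lambda>i. q ^ Suc N * q ^ i) has_sum q ^ Suc N / (1 - q)) UNIV"
    using assms by (intro sums_nonneg_imp_has_sum) auto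
  then show ?thesis
    unfolding atLeast_eq_range_add by (subst has_sum_reindex) (auto simp: o_def power_add mult.assoc)
qed

lemma is_subsumE:
  assumes "is_subsum m k t"
  obtains B where "B \<subseteq> {..<m}" "(\<Sum>i\<in>B. k (Suc i)) = t"
proof -
  obtain c :: "nat \<Rightarrow> real" where c: "\<forall>i\<in>{1..m}. c i \<in> {0, 1}" "t = (\<Sum>i=1..m. c i * k i)"
    using assms unfolding is_subsum_def by blast
  have "t = (\<Sum>i<m. c (Suc i) * k (Suc i))"
    unfolding c(2) by (simp add: sum.atLeast1_atMost_eq)
  also have "\<dots> = (\<Sum>i\<in>{i \<in> {..<m}. c (Suc i) = 1}. k (Suc i))"
    using c(1) by (subst sum.inter_filter) (auto intro!: sum.cong)
  finally show ?thesis by (intro that[of "{i \<in> {..<m}. c (Suc i) = 1}"]) auto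
qed

theorem corollary2p12:
  fixes f :: "real \<Rightarrow> real" and k :: "nat \<Rightarrow> real"
    and \<epsilon> a b r K lam mu d_CI d_NI :: real and m s :: nat
  assumes "0 < \<epsilon>" "\<epsilon> < 1" and "0 < a" "0 < b" "0 < r"
    and "mono_on {0..\<epsilon>} f"
    and "\<forall>x\<in>{0..\<epsilon>}. a * x powr r \<le> f x \<and> f x \<le> b * x powr r"
    and "1 \<le> m"
    and "\<forall>i\<in>{1..m}. \<forall>j\<in>{1..m}. i \<le> j \<longrightarrow> k j \<le> k i" and "0 < k m"
    and "K = (\<Sum>i=1..m. k i)"
    and "0 < lam" "0 < mu"
    and "\<forall>j\<le>s. is_subsum m k (mu + real j * lam)"
    and "d_CI = (b / (real s * a + b)) powr (1 / r)"
    and "d_NI = (a * k m / (b * K + a * k m)) powr (1 / r)"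
    and "d_CI < \<epsilon>" "d_CI < d_NI"
  shows "\<forall>x\<in>{d_CI..<d_NI}. x < \<epsilon> \<longrightarrow> cantorval (achievement_set (multigeometric m k f x))"
proof (intro ballI impI)
  fix x assume x: "x \<in> {d_CI..<d_NI}" "x < \<epsilon>"
  have k_pos: "0 < k i" if "i \<in> {1..m}" for i
    using assms(8,9,10) that by (meson atLeastAtMost_iff le_refl less_le_trans)
  have "0 \<le> K"
    unfolding assms(11) using k_pos by (intro sum_nonneg) (simp add: less_imp_le)
  have "0 < b / (real s * a + b)" using assms(3,4) by (simp add: add_nonneg_pos)
  then have "0 < d_CI" using assms(4,15) powr_gt_zero by fastforce
  then have "0 < x" using x by simp
  define q where "q = x powr r"
  have q: "0 < q" "q < 1"
    using \<open>0 < x\<close> x assms(2,5) powr_less_mono2[of r x 1] by (auto simp: q_def)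
  have d_powr: "((y :: real) powr (1 / r)) powr r = y" if "0 \<le> y" for y
    using assms(5) that by (simp add: powr_powr)
  have "b / (real s * a + b) \<le> q"
    using powr_mono2[of r d_CI x] x \<open>0 < d_CI\<close> assms(5) d_powr \<open>0 < b / _\<close>
    by (simp add: q_def assms(15))
  then have "b \<le> q * (real s * a + b)"
    using assms(3,4) by (simp add: pos_divide_le_eq add_nonneg_pos)
  then have CI: "b \<le> real s * (a * q / (1 - q))"
    using q by (simp add: field_simps)
  have "q < a * k m / (b * K + a * k m)"
    using powr_less_mono2[of r x d_NI] x \<open>0 < x\<close> assms(3,4,5,10) d_powr \<open>0 \<le> K\<close>
    by (simp add: q_def assms(16))
  then have NI: "K * (b * q / (1 - q)) < k m * a"
    using q assms(3,4,10) \<open>0 \<le> K\<close> by (simp add: field_simps add_nonneg_pos)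
  define F where "F j = f (x ^ Suc j)" for j
  have pow_in: "x ^ Suc j \<in> {0..\<epsilon>}" for j
    using \<open>0 < x\<close> x assms(2) power_decreasing[of 1 "Suc j" x] by (simp del: power_Suc)
  have pow_powr: "(x ^ Suc j) powr r = q ^ Suc j" for j
    using \<open>0 < x\<close> by (simp add: q_def powr_powr mult.commute flip: powr_realpow powr_power del: power_Suc)
  have F_bounds: "a * q ^ Suc j \<le> F j" "F j \<le> b * q ^ Suc j" for j
    using bspec[OF assms(7) pow_in[of j]] unfolding pow_powr F_def by blast+
  have F_pos: "0 < F j" for j
    using F_bounds(1)[of j] q assms(3) by (meson less_le_trans mult_pos_pos zero_less_power)
  have b_geo: "((\<lambda>j. b * q ^ Suc j) has_sum b * (q ^ Suc N / (1 - q))) {N..}" for N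
    using q by (intro has_sum_cmult_right geometric_tail_has_sum) auto
  have a_geo: "((\<lambda>j. a * q ^ Suc j) has_sum a * (q ^ Suc N / (1 - q))) {N..}" for N
    using q by (intro has_sum_cmult_right geometric_tail_has_sum) auto
  have F_summable: "F summable_on {N..}" for N
    by (rule summable_on_comparison_test[OF has_sum_imp_summable[OF b_geo]])
      (use F_bounds F_pos in \<open>auto intro: less_imp_le\<close>)
  show "cantorval (achievement_set (multigeometric m k f x))"
  proof (rule cantorval_block_weights)
    show "0 < m" using assms(8) by simp
    show "0 < k m" by fact
    show "k m \<le> k (Suc i)" if "i < m" for i
      using assms(9) that by auto
    show "0 < F j" for j by (rule F_pos)
    show "decseq F"
    proof (rule decseq_SucI)
      show "F (Suc j) \<le> F j" for j
        unfolding F_def using \<open>0 < x\<close> x assms(2) power_decreasing[of "Suc j" "Suc (Suc j)" x]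
        by (intro mono_onD[OF assms(6)] pow_in) auto
    qed
    show "F summable_on UNIV" using F_summable[of 0] by simp
    show "(\<Sum>i<m. k (Suc i)) * infsum F {Suc j..} < k m * F j" for j
    proof -
      have "infsum F {Suc j..} \<le> b * (q ^ Suc (Suc j) / (1 - q))"
        using has_sum_mono[OF has_sum_infsum[OF F_summable] b_geo F_bounds(2)] .
      then have "K * infsum F {Suc j..} \<le> K * (b * (q ^ Suc (Suc j) / (1 - q)))"
        using \<open>0 \<le> K\<close> by (rule mult_left_mono)
      also have "\<dots> = K * (b * q / (1 - q)) * q ^ Suc j" by simp
      also have "\<dots> < k m * a * q ^ Suc j"
        using NI q by (intro mult_strict_right_mono) auto
      also have "\<dots> \<le> k m * F j"
        using mult_left_mono[OF F_bounds(1), of "k m" j] assms(10) by (simp add: mult.assoc)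
      finally show ?thesis by (simp add: assms(11) sum.atLeast1_atMost_eq)
    qed
    show "F j \<le> real s * infsum F {Suc j..}" for j
    proof -
      have "F j \<le> b * q ^ Suc j" by (rule F_bounds)
      also have "\<dots> \<le> real s * (a * q / (1 - q)) * q ^ Suc j"
        using CI q by (intro mult_right_mono) auto
      also have "\<dots> = real s * (a * (q ^ Suc (Suc j) / (1 - q)))" by simp
      also have "\<dots> \<le> real s * infsum F {Suc j..}"
        by (intro mult_left_mono has_sum_mono[OF a_geo has_sum_infsum[OF F_summable] F_bounds(1)]) simp
      finally show ?thesis .
    qed
    show "0 < lam" by fact
    show "\<exists>B\<subseteq>{..<m}. (\<Sum>i\<in>B. k (Suc i)) = mu + real d * lam" if "d \<le> s" for d
      using is_subsumE[OF assms(14)[rule_format, OF that]] by blast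
    show "multigeometric m k f x (Suc n) = k (Suc (n mod m)) * F (n div m)" for n
      using assms(8) by (simp add: multigeometric_def F_def)
  qed
qed

end
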